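(* Let $s$ be a positive integer and let $p\ge 1$ be a real number satisfying $2p>s$. Then there is a constant $c_{p,s}$, depending only on $p$ and $s$, such that for every positive integer $n$, $$e_s(\ell_p^n)\le c_{p,s}\,n^{(2ps+2s)/(2p-s)}.$$
   Context: For real $p\ge 1$ and a positive integer $n$, $\ell_p^n=(\mathbb{R}^n,\|\cdot\|_p)$ is $\mathbb{R}^n$ with the norm $\|x\|_p=\left(\sum_{i=1}^n|x_i|^p\right)^{1/p}$ and distance $\|x-y\|_p$. A subset $S$ of a metric space $(X,d)$ is an $s$-distance set if the set $\{d(x,y): x,y\in S,\ x\ne y\}$ has cardinality $s$ (the distance $0$ is not counted). $e_s(X)$ denotes the maximum cardinality of an $s$-distance set in $X$; thus $e_s(X)\le N$ means that every $s$-distance set in $X$ has at most $N$ points. *)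

theory Defs
  imports Complex_Main "HOL-Library.FuncSet" "HOL-Library.Extended_Real"
begin

text \<open>
  The dimension varies inside the theorem, so \<open>\<real>\<^sup>n\<close> is the set of extensional
  functions on \<open>{..<n}\<close>; extensionality makes equality of functions
  coincide with equality of the first \<open>n\<close> coordinates.
\<close>

definition Rn :: "nat \<Rightarrow> (nat \<Rightarrow> real) set" where
  "Rn n = {..<n} \<rightarrow>\<^sub>E UNIV"

definition lp_norm :: "real \<Rightarrow> nat \<Rightarrow> (nat \<Rightarrow> real) \<Rightarrow> real" where
  "lp_norm p n x = (\<Sum>i<n. \<bar>x i\<bar> powr p) powr (1 / p)"

definition lp_dist :: "real \<Rightarrow> nat \<Rightarrow> (nat \<Rightarrow> real) \<Rightarrow> (nat \<Rightarrow> real) \<Rightarrow> real" where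
  "lp_dist p n x y = lp_norm p n (\<lambda>i. x i - y i)"

definition distances :: "('a \<Rightarrow> 'a \<Rightarrow> real) \<Rightarrow> 'a set \<Rightarrow> real set" where
  "distances d S = {d x y | x y. x \<in> S \<and> y \<in> S \<and> x \<noteq> y}"

definition s_distance_set :: "nat \<Rightarrow> 'a set \<Rightarrow> ('a \<Rightarrow> 'a \<Rightarrow> real) \<Rightarrow> 'a set \<Rightarrow> bool" where
  "s_distance_set s X d S \<longleftrightarrow>
     S \<subseteq> X \<and> finite (distances d S) \<and> card (distances d S) = s"

text \<open>
  \<open>card\<close> is \<open>0\<close> on infinite sets, so cardinalities are taken in \<open>enat\<close>;
  an infinite \<open>s\<close>-distance set would make \<open>max_s_distance\<close> infinite.
\<close>

definition ecard :: "'a set \<Rightarrow> enat" where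
  "ecard S = (if finite S then enat (card S) else \<infinity>)"

definition max_s_distance :: "nat \<Rightarrow> 'a set \<Rightarrow> ('a \<Rightarrow> 'a \<Rightarrow> real) \<Rightarrow> enat" where
  "max_s_distance s X d = (SUP S \<in> {S. s_distance_set s X d S}. ecard S)"

lemma max_s_distance_le_iff:
  "max_s_distance s X d \<le> enat N \<longleftrightarrow>
     (\<forall>S. s_distance_set s X d S \<longrightarrow> finite S \<and> card S \<le> N)"
  unfolding max_s_distance_def SUP_le_iff by (auto simp: ecard_def split: if_splits)

text \<open>A finite supremum over a nonempty family of \<open>enat\<close> values is attained.\<close>

lemma max_s_distance_attained:
  assumes "s_distance_set s X d S0" and "max_s_distance s X d < \<infinity>"
  shows "\<exists>S. s_distance_set s X d S \<and> finite S \<and> max_s_distance s X d = enat (card S)"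
proof -
  define A where "A = ecard ` {S. s_distance_set s X d S}"
  have ne: "A \<noteq> {}" using assms(1) by (auto simp: A_def)
  have sup: "Sup A = max_s_distance s X d" by (simp add: A_def max_s_distance_def)
  have "finite A"
    using assms(2) ne sup by (auto simp: Sup_enat_def split: if_splits)
  then have "Sup A \<in> A" using ne by (simp add: Sup_enat_def)
  then show ?thesis
    using assms(2) sup by (auto simp: A_def ecard_def split: if_splits)
qed

end

theory Submission
  imports Defs "HOL-Analysis.Generalised_Binomial_Theorem"
begin

text \<open>
  If the \<open>p\<close>-th powers \<open>a \<in> T\<close> of the distances occurring in \<open>S\<close> are within a bounded ratio of each
  other, the matrix \<open>\<Prod>a\<in>T. 1 - \<parallel>x - y\<parallel>\<^sub>p powr p / a\<close> indexed by \<open>S\<close> is the identity.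
  Replacing each \<open>\<bar>x i - y i\<bar> powr p\<close> by a piecewise Taylor polynomial in \<open>x i\<close> on \<open>O(d)\<close> cells makes
  its rank \<open>O((n d)^s)\<close> at the cost of an error \<open>O(n / d powr p)\<close> off the diagonal. A matrix of order \<open>m\<close>
  with unit diagonal and off-diagonal entries at most \<open>1 / sqrt m\<close> has rank at least \<open>m / 2\<close>, so
  \<open>d \<approx> (n * sqrt m) powr (1 / p)\<close> gives the bound on \<open>m = card S\<close>. If instead there is a large gap
  between two consecutive distances, \<open>S\<close> splits into clusters, and the bound follows by induction
  on \<open>s\<close> because its exponent is superadditive in \<open>s\<close>.
\<close>

subsection \<open>Kernels of finite rank\<close>

text \<open>An explicit sum of \<open>N\<close> rank-one kernels. Since \<open>f\<close> may vanish,
  the index is only an upper bound for the rank. A finite index set enters only once projections are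
  formed.\<close>

inductive kernel_rank_le :: "nat \<Rightarrow> ('a \<Rightarrow> 'b \<Rightarrow> real) \<Rightarrow> bool" where
  zero: "kernel_rank_le 0 (\<lambda>x y. 0)"
| step: "kernel_rank_le N A \<Longrightarrow> kernel_rank_le (Suc N) (\<lambda>x y. f x * g y + A x y)"

lemma kernel_rank_le_rank1: "kernel_rank_le 1 (\<lambda>x y. f x * g y)"
  using kernel_rank_le.step[OF kernel_rank_le.zero, of f g] by simp

lemma kernel_rank_le_add:
  assumes "kernel_rank_le N A" "kernel_rank_le M B"
  shows "kernel_rank_le (N + M) (\<lambda>x y. A x y + B x y)"
  using assms
proof (induction rule: kernel_rank_le.induct)
  case zero
  then show ?case by simp
next
  case (step N A f g)
  from kernel_rank_le.step[OF step.IH[OF step.prems], of f g]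
  show ?case by (simp add: add.assoc)
qed

lemma kernel_rank_le_mult_rank1:
  assumes "kernel_rank_le N A"
  shows "kernel_rank_le N (\<lambda>x y. f x * g y * A x y)"
  using assms
proof (induction rule: kernel_rank_le.induct)
  case zero
  then show ?case using kernel_rank_le.zero by simp
next
  case (step N A f' g')
  from kernel_rank_le.step[OF step.IH, of "\<lambda>x. f x * f' x" "\<lambda>x. g x * g' x"]
  show ?case by (simp add: algebra_simps)
qed

lemma kernel_rank_le_mult:
  assumes "kernel_rank_le N A" "kernel_rank_le M B"
  shows "kernel_rank_le (N * M) (\<lambda>x y. A x y * B x y)"
  using assms
proof (induction rule: kernel_rank_le.induct)
  case zero
  then show ?case using kernel_rank_le.zero by simp
next
  case (step N A f g)
  from kernel_rank_le_add[OF kernel_rank_le_mult_rank1[OF step.prems, of f g] step.IH[OF step.prems]]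
  show ?case by (simp add: algebra_simps)
qed

lemma kernel_rank_le_sum:
  assumes "finite I" "\<And>i. i \<in> I \<Longrightarrow> kernel_rank_le N (A i)"
  shows "kernel_rank_le (card I * N) (\<lambda>x y. \<Sum>i\<in>I. A i x y)"
  using assms
proof (induction I rule: finite_induct)
  case empty
  then show ?case using kernel_rank_le.zero by simp
next
  case (insert i I)
  have "kernel_rank_le (N + card I * N) (\<lambda>x y. A i x y + (\<Sum>i\<in>I. A i x y))"
    by (intro kernel_rank_le_add insert.IH) (use insert.prems in auto)
  then show ?case using insert.hyps by simp
qed

lemma kernel_rank_le_prod:
  assumes "finite I" "\<And>i. i \<in> I \<Longrightarrow> kernel_rank_le N (A i)"
  shows "kernel_rank_le (N ^ card I) (\<lambda>x y. \<Prod>i\<in>I. A i x y)"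
  using assms
proof (induction I rule: finite_induct)
  case empty
  then show ?case using kernel_rank_le_rank1[of "\<lambda>_. 1" "\<lambda>_. 1"] by simp
next
  case (insert i I)
  have "kernel_rank_le (N * N ^ card I) (\<lambda>x y. A i x y * (\<Prod>i\<in>I. A i x y))"
    by (intro kernel_rank_le_mult insert.IH) (use insert.prems in auto)
  then show ?case using insert.hyps by simp
qed

lemma kernel_rank_le_comp:
  assumes "kernel_rank_le N A"
  shows "kernel_rank_le N (\<lambda>x y. A (u x) (v y))"
  using assms
proof (induction rule: kernel_rank_le.induct)
  case zero
  then show ?case by (rule kernel_rank_le.zero)
next
  case (step N A f g)
  from kernel_rank_le.step[OF step.IH, of "\<lambda>x. f (u x)" "\<lambda>x. g (v x)"]
  show ?case .
qed

text \<open>Gram-Schmidt: when a term \<open>f x * g y\<close> is added, \<open>P\<close> is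
  enlarged by the projection onto \<open>w\<close>, the part of \<open>f\<close> orthogonal on
  \<open>S\<close> to the range of \<open>P\<close>. The trace grows by one, or not at all if
  \<open>w\<close> vanishes on \<open>S\<close>.\<close>

lemma kernel_rank_le_projection:
  fixes A :: "'a \<Rightarrow> 'b \<Rightarrow> real"
  assumes "kernel_rank_le N A" "finite S"
  obtains P where "\<And>x y. P x y = P y x"
    "\<And>x z. x \<in> S \<Longrightarrow> z \<in> S \<Longrightarrow> (\<Sum>y\<in>S. P x y * P y z) = P x z"
    "\<And>x y. x \<in> S \<Longrightarrow> (\<Sum>z\<in>S. P x z * A z y) = A x y"
    "(\<Sum>x\<in>S. P x x) \<le> real N"
proof -
  have "\<exists>P. (\<forall>x y. P x y = P y x) \<and>
    (\<forall>x z. x \<in> S \<longrightarrow> z \<in> S \<longrightarrow> (\<Sum>y\<in>S. P x y * P y z) = P x z) \<and>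
    (\<forall>x y. x \<in> S \<longrightarrow> (\<Sum>z\<in>S. P x z * A z y) = A x y) \<and>
    (\<Sum>x\<in>S. P x x) \<le> real N"
    using assms(1)
  proof (induction rule: kernel_rank_le.induct)
    case zero
    show ?case by (rule exI[of _ "\<lambda>_ _. 0"]) simp
  next
    case (step N A f g)
    then obtain P where sym: "\<And>x y. P x y = P y x"
      and idem: "\<And>x z. x \<in> S \<Longrightarrow> z \<in> S \<Longrightarrow> (\<Sum>y\<in>S. P x y * P y z) = P x z"
      and fixA: "\<And>x y. x \<in> S \<Longrightarrow> (\<Sum>z\<in>S. P x z * A z y) = A x y"
      and tr: "(\<Sum>x\<in>S. P x x) \<le> real N" by blast
    define w where "w x = f x - (\<Sum>y\<in>S. P x y * f y)" for x
    define r where "r = (\<Sum>x\<in>S. w x * w x)"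
    have Pw: "(\<Sum>y\<in>S. P x y * w y) = 0" if "x \<in> S" for x
    proof -
      have "(\<Sum>y\<in>S. P x y * (\<Sum>z\<in>S. P y z * f z)) = (\<Sum>z\<in>S. (\<Sum>y\<in>S. P x y * P y z) * f z)"
        unfolding sum_distrib_left sum_distrib_right by (subst sum.swap) (simp add: mult.assoc)
      also have "\<dots> = (\<Sum>z\<in>S. P x z * f z)" using that idem by simp
      finally show ?thesis by (simp add: w_def right_diff_distrib sum_subtractf)
    qed
    have Pw': "(\<Sum>y\<in>S. w y * P y x) = 0" if "x \<in> S" for x
      using Pw[OF that] by (simp add: sym[of _ x] mult.commute)
    have wA: "(\<Sum>x\<in>S. w x * A x y) = 0" for y
    proof -
      have "(\<Sum>x\<in>S. w x * A x y) = (\<Sum>x\<in>S. w x * (\<Sum>z\<in>S. P x z * A z y))"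
        using fixA by simp
      also have "\<dots> = (\<Sum>z\<in>S. (\<Sum>x\<in>S. w x * P x z) * A z y)"
        unfolding sum_distrib_left sum_distrib_right by (subst sum.swap) (simp add: mult.assoc)
      also have "\<dots> = 0" using Pw' by simp
      finally show ?thesis .
    qed
    have wf: "(\<Sum>x\<in>S. w x * f x) = r"
    proof -
      have "(\<Sum>x\<in>S. w x * (\<Sum>z\<in>S. P x z * f z)) = (\<Sum>z\<in>S. (\<Sum>x\<in>S. w x * P x z) * f z)"
        unfolding sum_distrib_left sum_distrib_right by (subst sum.swap) (simp add: mult.assoc)
      also have "\<dots> = 0" using Pw' by simp
      finally have "(\<Sum>x\<in>S. w x * w x) = (\<Sum>x\<in>S. w x * f x)"
        by (simp add: w_def right_diff_distrib sum_subtractf)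
      then show ?thesis by (simp add: r_def)
    qed
    define Q where "Q x y = P x y + w x * w y / r" for x y
    show ?case
    proof (cases "r = 0")
      case True
      then have "w x = 0" if "x \<in> S" for x
        using that assms(2) sum_nonneg_eq_0_iff[of S "\<lambda>x. w x * w x"] by (simp add: r_def)
      then have f: "(\<Sum>y\<in>S. P x y * f y) = f x" if "x \<in> S" for x
        using that by (force simp: w_def)
      have "(\<Sum>z\<in>S. P x z * (f z * g y + A z y)) = f x * g y + A x y" if "x \<in> S" for x y
        using f[OF that] fixA[OF that]
        by (simp add: distrib_left sum.distrib mult.assoc[symmetric] sum_distrib_right[symmetric])
      then show ?thesis using sym idem tr by (intro exI[of _ P]) auto
    next
      case r: False
      have 1: "Q x y = Q y x" for x y using sym by (simp add: Q_def mult.commute)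
      have 2: "(\<Sum>y\<in>S. Q x y * Q y z) = Q x z" if "x \<in> S" "z \<in> S" for x z
      proof -
        have "(\<Sum>y\<in>S. Q x y * Q y z) = (\<Sum>y\<in>S. P x y * P y z) + (\<Sum>y\<in>S. P x y * w y) * (w z / r)
            + (w x / r) * (\<Sum>y\<in>S. w y * P y z) + w x * w z / r / r * (\<Sum>y\<in>S. w y * w y)"
          unfolding Q_def sum_distrib_left sum_distrib_right sum.distrib[symmetric]
          by (rule sum.cong) (simp_all add: algebra_simps)
        also have "\<dots> = Q x z" using that idem Pw Pw' r by (simp add: Q_def r_def[symmetric])
        finally show ?thesis .
      qed
      have 3: "(\<Sum>z\<in>S. Q x z * (f z * g y + A z y)) = f x * g y + A x y" if "x \<in> S" for x y
      proof -
        have "(\<Sum>z\<in>S. Q x z * (f z * g y + A z y)) = (\<Sum>z\<in>S. P x z * f z) * g y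
            + (\<Sum>z\<in>S. P x z * A z y) + w x / r * (\<Sum>z\<in>S. w z * f z) * g y
            + w x / r * (\<Sum>z\<in>S. w z * A z y)"
          unfolding Q_def sum_distrib_left sum_distrib_right sum.distrib[symmetric]
          by (rule sum.cong) (simp_all add: algebra_simps)
        also have "\<dots> = (\<Sum>z\<in>S. P x z * f z) * g y + A x y + w x * g y"
          using that fixA wA wf r by simp
        also have "\<dots> = f x * g y + A x y" by (simp add: w_def algebra_simps)
        finally show ?thesis .
      qed
      have "(\<Sum>x\<in>S. Q x x) = (\<Sum>x\<in>S. P x x) + 1"
        using r by (simp add: Q_def sum.distrib sum_divide_distrib[symmetric] r_def[symmetric])
      then have 4: "(\<Sum>x\<in>S. Q x x) \<le> real (Suc N)" using tr by simp
      show ?thesis using 1 2 3 4 by (intro exI[of _ Q]) auto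
    qed
  qed
  with that show ?thesis by blast
qed

text \<open>With \<open>P\<close> the orthogonal projection onto the column space, the trace is the Frobenius
  inner product of \<open>P\<close> and \<open>A\<close>.\<close>

lemma trace_power2_le_rank:
  assumes "kernel_rank_le N A" "finite S"
  shows "(\<Sum>x\<in>S. A x x)\<^sup>2 \<le> real N * (\<Sum>x\<in>S. \<Sum>y\<in>S. (A x y)\<^sup>2)"
proof -
  obtain P where sym: "\<And>x y. P x y = P y x"
    and idem: "\<And>x z. x \<in> S \<Longrightarrow> z \<in> S \<Longrightarrow> (\<Sum>y\<in>S. P x y * P y z) = P x z"
    and fixA: "\<And>x y. x \<in> S \<Longrightarrow> (\<Sum>z\<in>S. P x z * A z y) = A x y"
    and tr: "(\<Sum>x\<in>S. P x x) \<le> real N"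
    using kernel_rank_le_projection[OF assms] by blast
  have "(\<Sum>x\<in>S. A x x) = (\<Sum>x\<in>S. \<Sum>z\<in>S. P z x * A z x)"
    using fixA sym by simp
  also have "\<dots> = (\<Sum>z\<in>S. \<Sum>x\<in>S. P z x * A z x)" by (rule sum.swap)
  also have "\<dots> = (\<Sum>i\<in>S\<times>S. case_prod P i * case_prod A i)"
    by (simp add: sum.cartesian_product split_def)
  finally have "(\<Sum>x\<in>S. A x x)\<^sup>2 \<le> (\<Sum>i\<in>S\<times>S. (case_prod P i)\<^sup>2) * (\<Sum>i\<in>S\<times>S. (case_prod A i)\<^sup>2)"
    by (simp add: Cauchy_Schwarz_ineq_sum)
  \<comment> \<open>By symmetry and idempotence the squared Frobenius norm of \<open>P\<close> is
    its trace, hence at most \<open>N\<close>.\<close>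
  also have "(\<Sum>i\<in>S\<times>S. (case_prod P i)\<^sup>2) = (\<Sum>x\<in>S. \<Sum>y\<in>S. P x y * P y x)"
    by (simp add: sum.cartesian_product split_def power2_eq_square sym[of "snd _"])
  also have "\<dots> = (\<Sum>x\<in>S. P x x)" using idem by simp
  also have "(\<Sum>i\<in>S\<times>S. (case_prod A i)\<^sup>2) = (\<Sum>x\<in>S. \<Sum>y\<in>S. (A x y)\<^sup>2)"
    by (simp add: sum.cartesian_product split_def)
  also have "(\<Sum>x\<in>S. P x x) * (\<Sum>x\<in>S. \<Sum>y\<in>S. (A x y)\<^sup>2) \<le> real N * (\<Sum>x\<in>S. \<Sum>y\<in>S. (A x y)\<^sup>2)"
    by (intro mult_right_mono tr sum_nonneg) auto
  finally show ?thesis .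
qed

text \<open>With m = \<open>card S\<close>, the trace is m and the squared Frobenius norm is at most
  m + m^2 / m = 2m, so the trace inequality gives m^2 <= 2 N m.\<close>

lemma card_le_twice_rank:
  assumes "kernel_rank_le N A" "finite S" "\<And>x. x \<in> S \<Longrightarrow> A x x = 1"
    and "\<And>x y. x \<in> S \<Longrightarrow> y \<in> S \<Longrightarrow> x \<noteq> y \<Longrightarrow> \<bar>A x y\<bar> \<le> 1 / sqrt (card S)"
  shows "card S \<le> 2 * N"
proof (cases "S = {}")
  case False
  define m where "m = real (card S)"
  have m: "m > 0" using False assms(2) by (simp add: m_def card_gt_0_iff)
  have sq: "(A x y)\<^sup>2 \<le> (if x = y then 1 else 0) + 1 / m" if "x \<in> S" "y \<in> S" for x y
  proof (cases "x = y")
    case False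
    have "(A x y)\<^sup>2 = \<bar>A x y\<bar>\<^sup>2" by simp
    also have "\<dots> \<le> (1 / sqrt m)\<^sup>2"
      using assms(4)[OF that False] by (intro power_mono) (auto simp: m_def)
    also have "\<dots> = 1 / m" using m by (simp add: power_divide)
    finally show ?thesis using False by simp
  qed (use assms(3) that m in auto)
  have "(\<Sum>x\<in>S. \<Sum>y\<in>S. (A x y)\<^sup>2) \<le> (\<Sum>x\<in>S. \<Sum>y\<in>S. (if x = y then 1 else 0) + 1 / m)"
    by (intro sum_mono sq)
  also have "\<dots> = 2 * m"
    using assms(2) m by (simp add: sum.distrib m_def[symmetric])
  finally have F: "(\<Sum>x\<in>S. \<Sum>y\<in>S. (A x y)\<^sup>2) \<le> 2 * m" .
  have "m\<^sup>2 \<le> real N * (\<Sum>x\<in>S. \<Sum>y\<in>S. (A x y)\<^sup>2)"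
    using trace_power2_le_rank[OF assms(1,2)] assms(3) by (simp add: m_def)
  also have "\<dots> \<le> real N * (2 * m)" by (intro mult_left_mono F) simp
  finally have "m \<le> 2 * real N" using m by (simp add: power2_eq_square)
  then show ?thesis by (simp add: m_def)
qed simp

subsection \<open>Low-rank approximation of the distance\<close>

text \<open>For |z| <= 1/2 the tail of the binomial series is |z|^M times a series that is dominated
  termwise by \<open>c\<close>, its absolute version at 1/2.\<close>

lemma powr_taylor_bound:
  fixes p :: real and M :: nat
  obtains C where "C \<ge> 0" "\<And>z. \<bar>z\<bar> \<le> 1/2 \<Longrightarrow>
    \<bar>(1 + z) powr p - (\<Sum>j<M. (p gchoose j) * z ^ j)\<bar> \<le> C * \<bar>z\<bar> ^ M"
proof
  define c where "c j = \<bar>p gchoose (j + M)\<bar> * (1/2) ^ j" for j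
  have sums: "(\<lambda>j. (p gchoose j) * z ^ j) sums (1 + z) powr p" if "\<bar>z\<bar> < 1" for z :: real
    using gen_binomial_real[OF that] .
  \<comment> \<open>Convergence at 3/4 yields absolute convergence at the smaller point 1/2.\<close>
  have "summable (\<lambda>j. (p gchoose j) * (3/4) ^ j)"
    using sums[of "3/4"] by (simp add: sums_iff)
  then have "summable (\<lambda>j. norm ((p gchoose j) * (1/2) ^ j))"
    by (rule powser_insidea) simp
  then have "summable (\<lambda>j. norm ((p gchoose (j+M)) * (1/2) ^ (j+M)))"
    by (rule summable_ignore_initial_segment)
  then have "summable (\<lambda>j. 2 ^ M * norm ((p gchoose (j+M)) * (1/2) ^ (j+M)))"
    by (rule summable_mult)
  also have "(\<lambda>j. 2 ^ M * norm ((p gchoose (j+M)) * (1/2) ^ (j+M))) = c"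
    by (rule ext) (simp add: c_def abs_mult power_add power_divide)
  finally have sc: "summable c" .
  show "suminf c \<ge> 0" by (rule suminf_nonneg[OF sc]) (simp add: c_def)
  fix z :: real assume z: "\<bar>z\<bar> \<le> 1/2"
  let ?t = "\<lambda>j. (p gchoose (j+M)) * z ^ (j+M)"
  have bd: "norm (?t j) \<le> c j * \<bar>z\<bar> ^ M" for j
  proof -
    have "\<bar>z\<bar> ^ j \<le> (1/2) ^ j" using z by (intro power_mono) auto
    then have "\<bar>p gchoose (j+M)\<bar> * \<bar>z\<bar> ^ j * \<bar>z\<bar> ^ M \<le> \<bar>p gchoose (j+M)\<bar> * (1/2) ^ j * \<bar>z\<bar> ^ M"
      by (intro mult_right_mono mult_left_mono) auto
    then show ?thesis by (simp add: c_def abs_mult power_abs power_add mult.assoc)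
  qed
  have st: "summable (\<lambda>j. (p gchoose j) * z ^ j)" "(\<Sum>j. (p gchoose j) * z ^ j) = (1 + z) powr p"
    using sums[of z] z by (auto simp: sums_iff)
  have "(1 + z) powr p - (\<Sum>j<M. (p gchoose j) * z ^ j) = suminf ?t"
    using suminf_split_initial_segment[OF st(1), of M] st(2) by simp
  also have "\<bar>\<dots>\<bar> \<le> (\<Sum>j. c j * \<bar>z\<bar> ^ M)"
    using norm_suminf_le[OF bd summable_mult2[OF sc]] by simp
  also have "\<dots> = suminf c * \<bar>z\<bar> ^ M" by (simp add: suminf_mult2[OF sc])
  finally show "\<bar>(1 + z) powr p - (\<Sum>j<M. (p gchoose j) * z ^ j)\<bar> \<le> suminf c * \<bar>z\<bar> ^ M" .
qed

text \<open>Factor out |u|^p and expand in \<open>z = t / u\<close>. As \<open>M\<close> is at least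
  \<open>p\<close> and |z| is at most \<delta> / |u| < 1, the remainder |u|^p |z|^M is at most
  \<open>\<delta> powr p\<close>, uniformly in \<open>u\<close>. Each term separates
  \<open>t\<close> from \<open>u\<close>, which is the source of the low rank.\<close>

lemma powr_difference_taylor_bound:
  fixes p t u \<delta> :: real
  assumes C: "\<And>z. \<bar>z\<bar> \<le> 1/2 \<Longrightarrow>
      \<bar>(1 + z) powr p - (\<Sum>j<M. (p gchoose j) * z ^ j)\<bar> \<le> C * \<bar>z\<bar> ^ M"
    and "C \<ge> 0" "p \<ge> 1" "p \<le> real M" "\<delta> > 0" "\<bar>t\<bar> \<le> \<delta>" "2 * \<delta> \<le> \<bar>u\<bar>"
  shows "\<bar>(\<Sum>j<M. t ^ j * ((p gchoose j) * \<bar>u\<bar> powr p / u ^ j)) - \<bar>u + t\<bar> powr p\<bar> \<le> C * \<delta> powr p"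
proof -
  have u: "\<bar>u\<bar> > 0" using assms by linarith
  define z where "z = t / u"
  have z: "\<bar>z\<bar> \<le> \<delta> / \<bar>u\<bar>" using assms u by (simp add: z_def divide_right_mono)
  have "\<delta> / \<bar>u\<bar> \<le> 1/2" using assms u by (simp add: field_simps)
  then have z2: "\<bar>z\<bar> \<le> 1/2" using z by linarith
  have "u + t = u * (1 + z)" using u by (simp add: z_def field_simps)
  then have ut: "\<bar>u + t\<bar> powr p = \<bar>u\<bar> powr p * (1 + z) powr p"
    using z2 by (simp add: abs_mult powr_mult)
  have "(\<Sum>j<M. t ^ j * ((p gchoose j) * \<bar>u\<bar> powr p / u ^ j))
      = \<bar>u\<bar> powr p * (\<Sum>j<M. (p gchoose j) * z ^ j)"
    unfolding sum_distrib_left by (rule sum.cong) (simp_all add: z_def power_divide)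
  with ut have "\<bar>(\<Sum>j<M. t ^ j * ((p gchoose j) * \<bar>u\<bar> powr p / u ^ j)) - \<bar>u + t\<bar> powr p\<bar>
      = \<bar>u\<bar> powr p * \<bar>(1 + z) powr p - (\<Sum>j<M. (p gchoose j) * z ^ j)\<bar>"
    by (simp add: right_diff_distrib[symmetric] abs_mult abs_minus_commute)
  also have "\<dots> \<le> \<bar>u\<bar> powr p * (C * \<bar>z\<bar> ^ M)"
    by (intro mult_left_mono C z2) simp
  also have "\<dots> \<le> \<bar>u\<bar> powr p * (C * (\<delta> / \<bar>u\<bar>) powr p)"
  proof (intro mult_left_mono)
    have "\<bar>z\<bar> ^ M \<le> (\<delta> / \<bar>u\<bar>) ^ M" using z by (intro power_mono) auto
    also have "\<dots> = (\<delta> / \<bar>u\<bar>) powr M"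
      using assms u by (simp add: powr_realpow)
    also have "\<dots> \<le> (\<delta> / \<bar>u\<bar>) powr p"
      using assms u by (intro powr_mono') (auto simp: field_simps)
    finally show "\<bar>z\<bar> ^ M \<le> (\<delta> / \<bar>u\<bar>) powr p" .
  qed (use assms in auto)
  also have "\<dots> = C * \<delta> powr p"
    using u assms by (simp add: powr_divide)
  finally show ?thesis .
qed

text \<open>Approximation in \<open>x\<close> by piecewise Taylor polynomials on cells of length \<open>\<delta>\<close>; cells close
  to \<open>y\<close> get the value \<open>0\<close>, since there \<open>\<bar>x - y\<bar> powr p\<close> is itself of order \<open>\<delta> powr p\<close>.\<close>

lemma powr_difference_low_rank:
  fixes p :: real
  assumes "p \<ge> 1"
  obtains C :: real and M :: nat where "C \<ge> 1" "\<And>(x0 :: real) (\<delta> :: real) (d :: nat). \<delta> > 0 \<Longrightarrow>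
    \<exists>g. kernel_rank_le ((2 * d + 1) * M) g \<and> (\<forall>x. g x x = 0) \<and>
      (\<forall>x y. \<bar>x - x0\<bar> \<le> d * \<delta> \<longrightarrow> \<bar>g x y - \<bar>x - y\<bar> powr p\<bar> \<le> C * \<delta> powr p)"
proof -
  define M where "M = nat \<lceil>p\<rceil>"
  have pM: "p \<le> real M" using assms by (simp add: M_def)
  obtain C0 where C0: "C0 \<ge> 0" "\<And>z. \<bar>z\<bar> \<le> 1/2 \<Longrightarrow>
      \<bar>(1 + z) powr p - (\<Sum>j<M. (p gchoose j) * z ^ j)\<bar> \<le> C0 * \<bar>z\<bar> ^ M"
    using powr_taylor_bound[of p M] by blast
  \<comment> \<open>The term \<open>3 powr p\<close> covers the cells near \<open>y\<close>, where
    |x - y| is at most 3 \<delta>.\<close>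
  define C where "C = C0 + 3 powr p"
  have C1: "C \<ge> 1" using C0(1) ge_one_powr_ge_zero[of 3 p] assms by (simp add: C_def)
  have approx: "\<exists>g. kernel_rank_le ((2 * d + 1) * M) g \<and> (\<forall>x. g x x = 0) \<and>
      (\<forall>x y. \<bar>x - x0\<bar> \<le> d * \<delta> \<longrightarrow> \<bar>g x y - \<bar>x - y\<bar> powr p\<bar> \<le> C * \<delta> powr p)"
    if \<delta>: "\<delta> > 0" for x0 \<delta> :: real and d :: nat
  proof -
    \<comment> \<open>Cells are numbered from the centre \<open>x0\<close>, and \<open>c l\<close>
      is the left endpoint of cell \<open>l\<close>. The range from -d to d includes the right end
      x0 + d \<delta>, which falls into cell d.\<close>
    define cell where "cell x = \<lfloor>(x - x0) / \<delta>\<rfloor>" for x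
    define c where "c l = x0 + real_of_int l * \<delta>" for l
    define h where "h l j y = (if \<bar>c l - y\<bar> < 2 * \<delta> then 0
      else (p gchoose j) * \<bar>c l - y\<bar> powr p / (c l - y) ^ j)" for l j y
    \<comment> \<open>The indicator selects the cell of \<open>x\<close>, so each pair of a cell and
      a degree contributes one product of a function of \<open>x\<close> and a function of
      \<open>y\<close>.\<close>
    define g where "g x y = (\<Sum>l\<in>{-int d..int d}. \<Sum>j<M.
      ((if cell x = l then 1 else 0) * (x - c l) ^ j) * h l j y)" for x y
    have "kernel_rank_le (card {-int d..int d} * (card {..<M} * 1)) g"
      unfolding g_def by (intro kernel_rank_le_sum kernel_rank_le_rank1) auto
    then have rank: "kernel_rank_le ((2 * d + 1) * M) g"
      by (simp add: nat_add_distrib nat_mult_distrib algebra_simps)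
    have cell: "0 \<le> x - c (cell x)" "x - c (cell x) \<le> \<delta>" for x
    proof -
      have "real_of_int (cell x) \<le> (x - x0) / \<delta>" "(x - x0) / \<delta> \<le> real_of_int (cell x) + 1"
        unfolding cell_def by linarith+
      then show "0 \<le> x - c (cell x)" "x - c (cell x) \<le> \<delta>"
        using \<delta> by (simp_all add: c_def field_simps)
    qed
    have g_eq: "g x y = (if cell x \<in> {-int d..int d} then \<Sum>j<M. (x - c (cell x)) ^ j * h (cell x) j y else 0)"
      for x y
    proof -
      have "g x y = (\<Sum>l\<in>{-int d..int d}. if cell x = l then \<Sum>j<M. (x - c l) ^ j * h l j y else 0)"
        unfolding g_def by (intro sum.cong) auto
      then show ?thesis by (simp add: sum.delta)
    qed
    \<comment> \<open>\<open>x\<close> is within \<delta> of the left end of its own cell, so the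
      default value 0 applies and the diagonal vanishes exactly. This makes the diagonal of the
      later product matrix exactly 1.\<close>
    have "g x x = 0" for x
    proof -
      have "h (cell x) j x = 0" for j using cell[of x] \<delta> by (simp add: h_def)
      then show ?thesis by (simp add: g_eq)
    qed
    moreover have "\<bar>g x y - \<bar>x - y\<bar> powr p\<bar> \<le> C * \<delta> powr p" if x: "\<bar>x - x0\<bar> \<le> d * \<delta>" for x y
    proof -
      have "-real d \<le> (x - x0) / \<delta>" "(x - x0) / \<delta> \<le> real d"
        using x \<delta> by (simp_all add: field_simps abs_le_iff)
      then have "cell x \<in> {-int d..int d}" unfolding cell_def
        by (simp add: le_floor_iff floor_le_iff)
      then have g: "g x y = (\<Sum>j<M. (x - c (cell x)) ^ j * h (cell x) j y)" by (simp add: g_eq)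
      show ?thesis
      proof (cases "\<bar>c (cell x) - y\<bar> < 2 * \<delta>")
        case True
        then have "\<bar>x - y\<bar> \<le> 3 * \<delta>" using cell[of x] by linarith
        then have "\<bar>x - y\<bar> powr p \<le> (3 * \<delta>) powr p" using assms by (intro powr_mono2) auto
        also have "\<dots> = 3 powr p * \<delta> powr p" using \<delta> by (simp add: powr_mult)
        also have "\<dots> \<le> C * \<delta> powr p" using C0 by (intro mult_right_mono) (auto simp: C_def)
        finally show ?thesis using True by (simp add: g h_def)
      next
        case False
        have "\<bar>(\<Sum>j<M. (x - c (cell x)) ^ j * ((p gchoose j) * \<bar>c (cell x) - y\<bar> powr p / (c (cell x) - y) ^ j))
            - \<bar>(c (cell x) - y) + (x - c (cell x))\<bar> powr p\<bar> \<le> C0 * \<delta> powr p"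
          by (rule powr_difference_taylor_bound[OF C0(2) C0(1) assms pM \<delta>]) (use cell[of x] False in auto)
        also have "\<dots> \<le> C * \<delta> powr p" by (intro mult_right_mono) (auto simp: C_def)
        finally show ?thesis using False by (simp add: g h_def)
      qed
    qed
    ultimately show ?thesis using rank by blast
  qed
  show ?thesis by (rule that[OF C1 approx])
qed

text \<open>The p-th power of the distance: being a sum over coordinates, it allows one-dimensional
  approximations to be added.\<close>

definition lp_pdist :: "real \<Rightarrow> nat \<Rightarrow> (nat \<Rightarrow> real) \<Rightarrow> (nat \<Rightarrow> real) \<Rightarrow> real" where
  "lp_pdist p n x y = (\<Sum>i<n. \<bar>x i - y i\<bar> powr p)"

lemma lp_pdist_commute: "lp_pdist p n x y = lp_pdist p n y x"
  by (simp add: lp_pdist_def abs_minus_commute)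

lemma lp_pdist_refl [simp]: "lp_pdist p n x x = 0"
  by (simp add: lp_pdist_def)

text \<open>From a + b <= 2 max a b in each coordinate. A triangle inequality up to a constant is
  enough to form clusters below a sufficiently large gap.\<close>

lemma lp_pdist_quasi_triangle:
  assumes "p \<ge> 0"
  shows "lp_pdist p n x z \<le> 2 powr p * (lp_pdist p n x y + lp_pdist p n y z)"
proof -
  have "\<bar>x i - z i\<bar> powr p \<le> 2 powr p * (\<bar>x i - y i\<bar> powr p + \<bar>y i - z i\<bar> powr p)" for i
  proof -
    define a b where "a = \<bar>x i - y i\<bar>" and "b = \<bar>y i - z i\<bar>"
    have "\<bar>x i - z i\<bar> \<le> a + b" unfolding a_def b_def by linarith
    also have "\<dots> \<le> 2 * max a b" by (simp add: max_def)
    finally have "\<bar>x i - z i\<bar> powr p \<le> (2 * max a b) powr p"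
      using assms by (intro powr_mono2) auto
    also have "\<dots> = 2 powr p * (max a b) powr p" by (simp add: powr_mult a_def b_def)
    also have "\<dots> \<le> 2 powr p * (a powr p + b powr p)"
      by (intro mult_left_mono) (auto simp: max_def)
    finally show ?thesis by (simp add: a_def b_def)
  qed
  then show ?thesis
    unfolding lp_pdist_def sum.distrib[symmetric] sum_distrib_left by (rule sum_mono)
qed

lemma lp_dist_eq_pdist: "lp_dist p n x y = lp_pdist p n x y powr (1 / p)"
  by (simp add: lp_dist_def lp_norm_def lp_pdist_def)

lemma lp_pdist_pos:
  assumes "x \<in> Rn n" "y \<in> Rn n" "x \<noteq> y"
  shows "lp_pdist p n x y > 0"
proof -
  obtain i where "i < n" "x i \<noteq> y i"
    using assms unfolding Rn_def by (metis PiE_ext lessThan_iff)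
  then show ?thesis unfolding lp_pdist_def
    by (intro sum_pos2[of _ i]) auto
qed

text \<open>The one-dimensional approximations are summed over the coordinates, so ranks and errors
  both pick up a factor \<open>n\<close>. Only \<open>x\<close> is confined to the cube around
  \<open>x0\<close>, and \<open>C\<close> and \<open>M\<close> are fixed before \<open>n\<close> and
  the mesh.\<close>

lemma lp_pdist_low_rank:
  fixes p :: real
  assumes "p \<ge> 1"
  obtains C :: real and M :: nat where "C \<ge> 1"
    "\<And>n (x0 :: nat \<Rightarrow> real) (\<delta> :: real) (d :: nat). \<delta> > 0 \<Longrightarrow>
    \<exists>G. kernel_rank_le (n * ((2 * d + 1) * M)) G \<and> (\<forall>x. G x x = 0) \<and>
      (\<forall>x y. (\<forall>i<n. \<bar>x i - x0 i\<bar> \<le> d * \<delta>) \<longrightarrow> \<bar>G x y - lp_pdist p n x y\<bar> \<le> n * (C * \<delta> powr p))"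
proof -
  obtain C :: real and M :: nat where C: "C \<ge> 1"
    and approx: "\<And>(x0 :: real) (\<delta> :: real) (d :: nat). \<delta> > 0 \<Longrightarrow>
    \<exists>g. kernel_rank_le ((2 * d + 1) * M) g \<and> (\<forall>x. g x x = 0) \<and>
      (\<forall>x y. \<bar>x - x0\<bar> \<le> d * \<delta> \<longrightarrow> \<bar>g x y - \<bar>x - y\<bar> powr p\<bar> \<le> C * \<delta> powr p)"
    by (rule powr_difference_low_rank[OF assms]) blast
  have approx_sum: "\<exists>G. kernel_rank_le (n * ((2 * d + 1) * M)) G \<and> (\<forall>x. G x x = 0) \<and>
      (\<forall>x y. (\<forall>i<n. \<bar>x i - x0 i\<bar> \<le> d * \<delta>) \<longrightarrow> \<bar>G x y - lp_pdist p n x y\<bar> \<le> n * (C * \<delta> powr p))"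
    if \<delta>: "\<delta> > 0" for n d and x0 :: "nat \<Rightarrow> real" and \<delta> :: real
  proof -
    have "\<forall>i. \<exists>g. kernel_rank_le ((2 * d + 1) * M) g \<and> (\<forall>x. g x x = 0) \<and>
      (\<forall>x y. \<bar>x - x0 i\<bar> \<le> d * \<delta> \<longrightarrow> \<bar>g x y - \<bar>x - y\<bar> powr p\<bar> \<le> C * \<delta> powr p)"
      using approx[OF \<delta>] by blast
    then obtain g where rank: "\<And>i. kernel_rank_le ((2 * d + 1) * M) (g i)"
      and diag: "\<And>i x. g i x x = 0"
      and close: "\<And>i x y. \<bar>x - x0 i\<bar> \<le> d * \<delta> \<Longrightarrow> \<bar>g i x y - \<bar>x - y\<bar> powr p\<bar> \<le> C * \<delta> powr p"
      by metis
    define G where "G x y = (\<Sum>i<n. g i (x i) (y i))" for x y :: "nat \<Rightarrow> real"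
    have "kernel_rank_le ((2 * d + 1) * M) (\<lambda>x y. g i (x i) (y i))" for i
      by (rule kernel_rank_le_comp[OF rank])
    then have "kernel_rank_le (card {..<n} * ((2 * d + 1) * M)) G"
      unfolding G_def by (intro kernel_rank_le_sum) auto
    moreover have "\<bar>G x y - lp_pdist p n x y\<bar> \<le> n * (C * \<delta> powr p)"
      if "\<forall>i<n. \<bar>x i - x0 i\<bar> \<le> d * \<delta>" for x y
    proof -
      have "\<bar>G x y - lp_pdist p n x y\<bar> \<le> (\<Sum>i<n. \<bar>g i (x i) (y i) - \<bar>x i - y i\<bar> powr p\<bar>)"
        unfolding G_def lp_pdist_def sum_subtractf[symmetric] by (rule sum_abs)
      also have "\<dots> \<le> (\<Sum>i<n. C * \<delta> powr p)"
        using that by (intro sum_mono close) simp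
      finally show ?thesis by simp
    qed
    ultimately show ?thesis using diag by (intro exI[of _ G]) (simp add: G_def)
  qed
  show ?thesis by (rule that[OF C approx_sum])
qed

subsection \<open>Distances of bounded ratio\<close>

text \<open>Here \<open>v\<close> approximates the distance \<open>b\<close>. The factor at
  \<open>b\<close> is at most \<open>\<eta>\<close>, and every factor is at most 1 + b / a + \<eta>,
  hence at most \<open>2 + R\<close>.\<close>

lemma abs_prod_one_minus_divide_le:
  fixes T :: "real set" and b \<eta> R v :: real
  assumes "finite T" "b \<in> T" "0 \<le> \<eta>" "\<eta> \<le> 1" "0 \<le> R"
    and pos: "\<And>a. a \<in> T \<Longrightarrow> a > 0"
    and ratio: "\<And>a. a \<in> T \<Longrightarrow> b \<le> R * a"
    and close: "\<And>a. a \<in> T \<Longrightarrow> \<bar>v - b\<bar> \<le> \<eta> * a"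
  shows "\<bar>\<Prod>a\<in>T. 1 - v / a\<bar> \<le> \<eta> * (2 + R) ^ card T"
proof -
  have b: "b > 0" using pos assms(2) by simp
  have "\<bar>1 - v / b\<bar> = \<bar>v - b\<bar> / b" using b by (simp add: abs_if field_simps)
  also have "\<dots> \<le> \<eta>" using close[OF assms(2)] b by (simp add: field_simps)
  finally have 1: "\<bar>1 - v / b\<bar> \<le> \<eta>" .
  have 2: "\<bar>1 - v / a\<bar> \<le> 2 + R" if "a \<in> T" for a
  proof -
    have a: "a > 0" using pos that by simp
    have "\<bar>a - v\<bar> \<le> a + b + \<bar>v - b\<bar>" using a b by linarith
    also have "\<dots> \<le> a + R * a + \<eta> * a" using ratio[OF that] close[OF that] by linarith
    also have "\<dots> \<le> a + R * a + 1 * a" using assms(4) a by (intro add_left_mono mult_right_mono) auto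
    also have "\<dots> = (2 + R) * a" by (simp add: algebra_simps)
    finally have "\<bar>a - v\<bar> / a \<le> 2 + R" using a by (simp add: field_simps)
    moreover have "1 - v / a = (a - v) / a" using a by (simp add: field_simps)
    ultimately show ?thesis using a by (simp add: abs_divide)
  qed
  have "\<bar>\<Prod>a\<in>T. 1 - v / a\<bar> = \<bar>1 - v / b\<bar> * (\<Prod>a\<in>T-{b}. \<bar>1 - v / a\<bar>)"
    by (simp add: prod.remove[OF assms(1,2)] abs_mult abs_prod)
  also have "\<dots> \<le> \<eta> * (\<Prod>a\<in>T-{b}. 2 + R)"
    using 1 2 assms(3) by (intro mult_mono prod_mono prod_nonneg) auto
  also have "(\<Prod>a\<in>T-{b}. 2 + R) \<le> (2 + R) ^ card T"
    using assms by (auto intro!: power_increasing card_mono)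
  finally show ?thesis using assms(3) by (simp add: mult_left_mono)
qed

lemma finite_distances: "finite S \<Longrightarrow> finite (distances d S)"
  by (rule finite_subset[of _ "(\<lambda>(x, y). d x y) ` (S \<times> S)"]) (auto simp: distances_def)

lemma lp_pdist_coord_le:
  assumes "p > 0" "i < n"
  shows "\<bar>x i - y i\<bar> \<le> lp_pdist p n x y powr (1 / p)"
proof -
  have "\<bar>x i - y i\<bar> powr p \<le> lp_pdist p n x y"
    unfolding lp_pdist_def using assms(2) by (intro member_le_sum) auto
  then have "(\<bar>x i - y i\<bar> powr p) powr (1 / p) \<le> lp_pdist p n x y powr (1 / p)"
    using assms by (intro powr_mono2) auto
  then show ?thesis using assms by (simp add: powr_powr)
qed

text \<open>The product matrix is formed from the approximation \<open>G\<close> instead of the true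
  distances. The hypothesis relating \<open>d\<close> to \<open>E\<close> is what pushes its
  off-diagonal entries below 1 / sqrt (card S), so that \<open>card_le_twice_rank\<close>
  applies.\<close>

lemma bounded_ratio_rank_bound:
  fixes p R :: real
  assumes p: "p \<ge> 1" and R: "R \<ge> 1"
  obtains E :: real and M :: nat where "E \<ge> 1"
    "\<And>n d S. d \<ge> 1 \<Longrightarrow> finite S \<Longrightarrow> card S \<ge> 2 \<Longrightarrow>
      (\<And>x y. x \<in> S \<Longrightarrow> y \<in> S \<Longrightarrow> x \<noteq> y \<Longrightarrow> lp_pdist p n x y > 0) \<Longrightarrow>
      (\<And>a b. a \<in> distances (lp_pdist p n) S \<Longrightarrow> b \<in> distances (lp_pdist p n) S \<Longrightarrow> b \<le> R * a) \<Longrightarrow>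
      card (distances (lp_pdist p n) S) \<le> s \<Longrightarrow>
      E * n * sqrt (card S) \<le> real d powr p \<Longrightarrow>
      card S \<le> 2 * (1 + n * ((2 * d + 1) * M)) ^ s"
proof -
  obtain C :: real and M :: nat where C: "C \<ge> 1"
    and approx: "\<And>n (x0 :: nat \<Rightarrow> real) (\<delta> :: real) (d :: nat). \<delta> > 0 \<Longrightarrow>
    \<exists>G. kernel_rank_le (n * ((2 * d + 1) * M)) G \<and> (\<forall>x. G x x = 0) \<and>
      (\<forall>x y. (\<forall>i<n. \<bar>x i - x0 i\<bar> \<le> d * \<delta>) \<longrightarrow> \<bar>G x y - lp_pdist p n x y\<bar> \<le> n * (C * \<delta> powr p))"
    by (rule lp_pdist_low_rank[OF p]) blast
  \<comment> \<open>Chosen so that \<open>\<eta> * K\<close> below equals E n / d^p.\<close>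
  define E where "E = C * R * (2 + R) ^ s"
  have E1: "E \<ge> 1"
    using C R unfolding E_def by (metis (no_types, opaque_lifting) add_increasing mult_ge1_I one_le_power zero_le_numeral)
  have "card S \<le> 2 * (1 + n * ((2 * d + 1) * M)) ^ s"
    if d: "d \<ge> 1" and fin: "finite S" and S2: "card S \<ge> 2"
      and pos: "\<And>x y. x \<in> S \<Longrightarrow> y \<in> S \<Longrightarrow> x \<noteq> y \<Longrightarrow> lp_pdist p n x y > 0"
      and ratio: "\<And>a b. a \<in> distances (lp_pdist p n) S \<Longrightarrow> b \<in> distances (lp_pdist p n) S \<Longrightarrow> b \<le> R * a"
      and cardT: "card (distances (lp_pdist p n) S) \<le> s"
      and dE: "E * n * sqrt (card S) \<le> real d powr p"
    for n d S
  proof -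
    define T where "T = distances (lp_pdist p n) S"
    define m where "m = real (card S)"
    have finT: "finite T" using fin by (simp add: T_def finite_distances)
    obtain x0 y0 where xy0: "x0 \<in> S" "y0 \<in> S" "x0 \<noteq> y0"
      using S2 fin by (metis One_nat_def card_le_Suc0_iff_eq not_less_eq_eq numeral_2_eq_2)
    have T_pos: "a > 0" if "a \<in> T" for a using that pos by (auto simp: T_def distances_def)
    have neT: "T \<noteq> {}" using xy0 by (auto simp: T_def distances_def)
    define D where "D = Max T"
    have D: "D \<in> T" "\<And>a. a \<in> T \<Longrightarrow> a \<le> D" using finT neT by (auto simp: D_def)
    have D_pos: "D > 0" using D T_pos by simp
    \<comment> \<open>With this mesh, d \<delta> is the p-th root of the largest value
      \<open>D\<close>, so every point of \<open>S\<close> is within d \<delta> of \<open>x0\<close>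
      in each coordinate.\<close>
    define \<delta> where "\<delta> = D powr (1 / p) / d"
    have \<delta>: "\<delta> > 0" using D_pos d by (simp add: \<delta>_def)
    have \<delta>p: "\<delta> powr p = D / d powr p"
      using D_pos d p by (simp add: \<delta>_def powr_divide powr_powr)
    obtain G where G: "kernel_rank_le (n * ((2 * d + 1) * M)) G" "\<And>x. G x x = 0"
      "\<And>x y. (\<forall>i<n. \<bar>x i - x0 i\<bar> \<le> d * \<delta>) \<Longrightarrow> \<bar>G x y - lp_pdist p n x y\<bar> \<le> n * (C * \<delta> powr p)"
      using approx[OF \<delta>, of n d x0] by blast
    \<comment> \<open>The error relative to any a in \<open>T\<close>: the absolute error is n C D /
      d^p, and \<open>D \<le> R * a\<close>.\<close>
    define \<eta> where "\<eta> = n * C * R / d powr p"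
    define K where "K = (2 + R) ^ s"
    have K1: "K \<ge> 1" using R by (simp add: K_def)
    have \<eta>0: "\<eta> \<ge> 0" using C R by (simp add: \<eta>_def)
    have m: "m \<ge> 2" using S2 by (simp add: m_def)
    have \<eta>K: "\<eta> * K \<le> 1 / sqrt m"
    proof -
      have "\<eta> * K * sqrt m = (E * n * sqrt m) / d powr p"
        by (simp add: \<eta>_def E_def K_def)
      also have "\<dots> \<le> 1" using dE d by (simp add: m_def)
      finally show ?thesis using m by (simp add: field_simps)
    qed
    have \<eta>1: "\<eta> \<le> 1"
    proof -
      have "\<eta> * 1 \<le> \<eta> * K" using \<eta>0 K1 by (intro mult_left_mono)
      also have "\<dots> \<le> 1 / sqrt m" by (rule \<eta>K)
      also have "\<dots> \<le> 1" using m by simp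
      finally show ?thesis by simp
    qed
    have close: "\<bar>G x y - lp_pdist p n x y\<bar> \<le> \<eta> * a" if "x \<in> S" "y \<in> S" "a \<in> T" for x y a
    proof -
      have "\<bar>x i - x0 i\<bar> \<le> d * \<delta>" if "i < n" for i
      proof -
        have "lp_pdist p n x x0 \<le> D"
        proof (cases "x = x0")
          case False
          then show ?thesis using D(2) \<open>x \<in> S\<close> xy0 by (auto simp: T_def distances_def)
        qed (use D_pos in simp)
        then have "lp_pdist p n x x0 powr (1 / p) \<le> D powr (1 / p)"
          using p by (intro powr_mono2) (auto simp: lp_pdist_def sum_nonneg)
        then show ?thesis using lp_pdist_coord_le[of p i n x x0] p that d by (simp add: \<delta>_def)
      qed
      then have "\<bar>G x y - lp_pdist p n x y\<bar> \<le> n * (C * \<delta> powr p)" by (intro G(3)) simp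
      also have "\<dots> = (n * C / d powr p) * D" by (simp add: \<delta>p)
      also have "\<dots> \<le> (n * C / d powr p) * (R * a)"
        using ratio[of a D] D that C by (intro mult_left_mono) (auto simp: T_def)
      also have "\<dots> = \<eta> * a" by (simp add: \<eta>_def)
      finally show ?thesis .
    qed
    define A where "A x y = (\<Prod>a\<in>T. 1 - G x y / a)" for x y
    \<comment> \<open>Each factor is a constant kernel plus a rescaled \<open>G\<close>, which adds
      1 to the rank bound.\<close>
    have "kernel_rank_le (1 + n * ((2 * d + 1) * M)) (\<lambda>x y. 1 * 1 + - 1 / a * 1 * G x y)" for a
      by (intro kernel_rank_le_add kernel_rank_le_rank1[of "\<lambda>_. 1" "\<lambda>_. 1"]
          kernel_rank_le_mult_rank1[OF G(1), of "\<lambda>_. - 1 / a" "\<lambda>_. 1"])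
    then have "kernel_rank_le ((1 + n * ((2 * d + 1) * M)) ^ card T) A"
      unfolding A_def using finT by (intro kernel_rank_le_prod) auto
    moreover have "A x x = 1" for x by (simp add: A_def G(2))
    moreover have "\<bar>A x y\<bar> \<le> 1 / sqrt (card S)" if "x \<in> S" "y \<in> S" "x \<noteq> y" for x y
    proof -
      have xyT: "lp_pdist p n x y \<in> T" using that by (auto simp: T_def distances_def)
      have "\<bar>A x y\<bar> \<le> \<eta> * (2 + R) ^ card T"
        unfolding A_def using xyT finT \<eta>0 \<eta>1 R T_pos ratio close that
        by (intro abs_prod_one_minus_divide_le[where b = "lp_pdist p n x y"]) (auto simp: T_def)
      also have "\<dots> \<le> \<eta> * K"
        unfolding K_def using cardT R \<eta>0 by (intro mult_left_mono power_increasing) (auto simp: T_def)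
      finally show ?thesis using \<eta>K by (simp add: m_def)
    qed
    ultimately have "card S \<le> 2 * (1 + n * ((2 * d + 1) * M)) ^ card T"
      using fin by (intro card_le_twice_rank[where A = A]) auto
    also have "\<dots> \<le> 2 * (1 + n * ((2 * d + 1) * M)) ^ s"
      using cardT by (intro mult_left_mono power_increasing) (auto simp: T_def)
    finally show ?thesis .
  qed
  then show ?thesis by (rule that[OF E1])
qed

text \<open>For p > 0 and 2p > s this is s (1 + 1/p) / (1 - s / (2p)), the power of n obtained by
  solving m <= const n^(s (1 + 1/p)) m^(s / (2p)) for m.\<close>

definition distance_exponent :: "real \<Rightarrow> nat \<Rightarrow> real" where
  "distance_exponent p s = (2 * p * real s + 2 * real s) / (2 * p - real s)"

lemma distance_exponent_nonneg: "p > 0 \<Longrightarrow> 2 * p > real s \<Longrightarrow> distance_exponent p s \<ge> 0"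
  by (simp add: distance_exponent_def)

text \<open>The denominator 2p - i decreases in i, so for i <= s the exponent at i is at most i (2p
  + 2) / (2p - s). This bound is linear in i and attained at i = s.\<close>

lemma distance_exponent_superadditive:
  assumes "p > 0" "j + k \<le> s" "2 * p > real s"
  shows "distance_exponent p j + distance_exponent p k \<le> distance_exponent p s"
proof -
  have *: "distance_exponent p i \<le> real i * ((2 * p + 2) / (2 * p - real s))" if "i \<le> s" for i
  proof -
    have "distance_exponent p i = real i * ((2 * p + 2) / (2 * p - real i))"
      by (simp add: distance_exponent_def algebra_simps)
    also have "\<dots> \<le> real i * ((2 * p + 2) / (2 * p - real s))"
      using that assms by (intro mult_left_mono divide_left_mono mult_pos_pos) auto
    finally show ?thesis .
  qed
  have "distance_exponent p j + distance_exponent p k \<le> real (j + k) * ((2 * p + 2) / (2 * p - real s))"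
    using add_mono[OF *[of j] *[of k]] assms(2) by (simp only: distrib_right of_nat_add)
  also have "\<dots> \<le> real s * ((2 * p + 2) / (2 * p - real s))"
    using assms by (intro mult_right_mono) auto
  also have "\<dots> = distance_exponent p s" by (simp add: distance_exponent_def algebra_simps)
  finally show ?thesis .
qed

text \<open>Absorbs the power of \<open>m\<close> on the right-hand side, which arises because the
  mesh has to be refined as the set grows.\<close>

lemma powr_bootstrap:
  fixes m N \<beta> :: real
  assumes "m > 0" "N \<ge> 0" "\<beta> < 1" "m \<le> N * m powr \<beta>"
  shows "m \<le> N powr (1 / (1 - \<beta>))"
proof -
  have "m powr (1 - \<beta>) = m / m powr \<beta>" using assms by (simp add: powr_diff)
  also have "\<dots> \<le> N" using assms by (simp add: field_simps)
  finally have "(m powr (1 - \<beta>)) powr (1 / (1 - \<beta>)) \<le> N powr (1 / (1 - \<beta>))"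
    using assms by (intro powr_mono2) auto
  then show ?thesis using assms by (simp add: powr_powr)
qed

text \<open>Taking d of order (n sqrt m)^(1/p), the least that the rank bound admits, gives m <=
  const n^(s (1 + 1/p)) m^(s / (2p)). As s < 2p, the power of m on the right is below 1 and can be
  absorbed.\<close>

lemma bounded_ratio_card_bound:
  fixes p R :: real
  assumes p: "p \<ge> 1" and ps: "2 * p > real s" and R: "R \<ge> 1"
  obtains c :: real where "c \<ge> 1"
    "\<And>n S. n \<ge> 1 \<Longrightarrow> finite S \<Longrightarrow>
      (\<And>x y. x \<in> S \<Longrightarrow> y \<in> S \<Longrightarrow> x \<noteq> y \<Longrightarrow> lp_pdist p n x y > 0) \<Longrightarrow>
      (\<And>a b. a \<in> distances (lp_pdist p n) S \<Longrightarrow> b \<in> distances (lp_pdist p n) S \<Longrightarrow> b \<le> R * a) \<Longrightarrow>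
      card (distances (lp_pdist p n) S) \<le> s \<Longrightarrow>
      real (card S) \<le> c * real n powr distance_exponent p s"
proof -
  obtain E :: real and M :: nat where E: "E \<ge> 1"
    and rank: "\<And>n d S. d \<ge> 1 \<Longrightarrow> finite S \<Longrightarrow> card S \<ge> 2 \<Longrightarrow>
      (\<And>x y. x \<in> S \<Longrightarrow> y \<in> S \<Longrightarrow> x \<noteq> y \<Longrightarrow> lp_pdist p n x y > 0) \<Longrightarrow>
      (\<And>a b. a \<in> distances (lp_pdist p n) S \<Longrightarrow> b \<in> distances (lp_pdist p n) S \<Longrightarrow> b \<le> R * a) \<Longrightarrow>
      card (distances (lp_pdist p n) S) \<le> s \<Longrightarrow>
      E * n * sqrt (card S) \<le> real d powr p \<Longrightarrow>
      card S \<le> 2 * (1 + n * ((2 * d + 1) * M)) ^ s"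
    by (rule bounded_ratio_rank_bound[OF p R, of s]) blast
  define \<beta> where "\<beta> = real s / (2 * p)"
  have \<beta>: "\<beta> < 1" using p ps by (simp add: \<beta>_def)
  \<comment> \<open>Collects 1 + 3M from the rank bound, the factor 2 from rounding \<open>X\<close>
    up to \<open>d\<close>, and the contribution of \<open>E\<close>.\<close>
  define L where "L = 2 * (1 + 3 * real M) * E powr (1 / p)"
  have L: "L \<ge> 1"
  proof -
    have "1 * 1 \<le> (2 * (1 + 3 * real M)) * E powr (1 / p)"
      using E p by (intro mult_mono) (auto simp: ge_one_powr_ge_zero)
    then show ?thesis by (simp add: L_def)
  qed
  define c where "c = (2 * L ^ s) powr (1 / (1 - \<beta>))"
  have c1: "c \<ge> 1"
  proof -
    have "L ^ s \<ge> 1" using L by (rule one_le_power)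
    then show ?thesis unfolding c_def using \<beta> by (intro ge_one_powr_ge_zero) auto
  qed
  have bound: "real (card S) \<le> c * real n powr distance_exponent p s"
    if n: "n \<ge> 1" and fin: "finite S"
      and pos: "\<And>x y. x \<in> S \<Longrightarrow> y \<in> S \<Longrightarrow> x \<noteq> y \<Longrightarrow> lp_pdist p n x y > 0"
      and ratio: "\<And>a b. a \<in> distances (lp_pdist p n) S \<Longrightarrow> b \<in> distances (lp_pdist p n) S \<Longrightarrow> b \<le> R * a"
      and cardT: "card (distances (lp_pdist p n) S) \<le> s"
    for n S
  proof (cases "card S \<ge> 2")
    case False
    have "1 * 1 \<le> c * real n powr distance_exponent p s"
      using c1 n distance_exponent_nonneg[of p s] p ps by (intro mult_mono ge_one_powr_ge_zero) auto
    then show ?thesis using False by simp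
  next
    case S2: True
    define m where "m = real (card S)"
    have m: "m \<ge> 2" using S2 by (simp add: m_def)
    define X where "X = (E * n * sqrt m) powr (1 / p)"
    have "1 * 1 * 1 \<le> E * n * sqrt m" using E n m by (intro mult_mono) auto
    then have X1: "X \<ge> 1" using p by (simp add: X_def ge_one_powr_ge_zero)
    define d where "d = nat \<lceil>X\<rceil>"
    have d: "X \<le> real d" "real d \<le> 2 * X" using X1 by (auto simp: d_def) linarith+
    have d1: "d \<ge> 1" using X1 d by linarith
    have "E * n * sqrt m = X powr p" using p E m by (simp add: X_def powr_powr)
    also have "\<dots> \<le> real d powr p" using X1 d p by (intro powr_mono2) auto
    finally have "card S \<le> 2 * (1 + n * ((2 * d + 1) * M)) ^ s"
      using d1 fin S2 pos ratio cardT by (intro rank) (auto simp: m_def)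
    then have "m \<le> real (2 * (1 + n * ((2 * d + 1) * M)) ^ s)" unfolding m_def of_nat_le_iff .
    also have "\<dots> = 2 * real (1 + n * ((2 * d + 1) * M)) ^ s" by simp
    also have "\<dots> \<le> 2 * (L * n powr (1 + 1 / p) * m powr (1 / (2 * p))) ^ s"
    proof (intro mult_left_mono power_mono)
      have "1 + n * ((2 * d + 1) * M) \<le> n * d + n * ((2 * d + d) * M)"
        using n d1 by (intro add_mono mult_le_mono) auto
      then have "real (1 + n * ((2 * d + 1) * M)) \<le> real (n * d + n * ((2 * d + d) * M))"
        by (simp only: of_nat_le_iff)
      also have "\<dots> = real n * (1 + 3 * real M) * real d" by (simp add: algebra_simps)
      also have "\<dots> \<le> real n * (1 + 3 * real M) * (2 * X)"
        using d by (intro mult_left_mono) auto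
      also have "\<dots> = real n * (2 * (1 + 3 * real M)) * X" by simp
      also have "X = E powr (1 / p) * n powr (1 / p) * m powr (1 / (2 * p))"
        using E m by (simp add: X_def powr_mult powr_half_sqrt[symmetric] powr_powr)
      also have "real n * (2 * (1 + 3 * real M)) * \<dots>
          = L * (real n * n powr (1 / p)) * m powr (1 / (2 * p))" by (simp add: L_def)
      also have "real n * n powr (1 / p) = n powr (1 + 1 / p)"
        using n by (simp add: powr_add)
      finally show "real (1 + n * ((2 * d + 1) * M)) \<le> L * n powr (1 + 1 / p) * m powr (1 / (2 * p))" .
    qed auto
    also have "\<dots> = 2 * L ^ s * n powr (real s * (1 + 1 / p)) * m powr \<beta>"
      using n m by (simp add: power_mult_distrib powr_power \<beta>_def mult.commute)
    finally have "m \<le> (2 * L ^ s * n powr (real s * (1 + 1 / p))) powr (1 / (1 - \<beta>))"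
      using m L \<beta> by (intro powr_bootstrap) auto
    also have "\<dots> = c * n powr (real s * (1 + 1 / p) / (1 - \<beta>))"
      using L by (simp add: c_def powr_mult powr_powr)
    also have "real s * (1 + 1 / p) / (1 - \<beta>) = distance_exponent p s"
      using p ps by (simp add: \<beta>_def distance_exponent_def field_simps)
    finally show ?thesis by (simp add: m_def)
  qed
  show ?thesis by (rule that[OF c1 bound])
qed

subsection \<open>Gaps between the distances\<close>

text \<open>From \<open>t\<close> one climbs to the maximum in steps of ratio at most
  \<open>B\<close>. Each step leaves fewer elements above, which drives the induction and bounds the
  number of steps by \<open>card T\<close>.\<close>

lemma no_gap_ratio_le:
  fixes T :: "real set"
  assumes "finite T" "B \<ge> 1" "\<And>a. a \<in> T \<Longrightarrow> a > 0"
    and no_gap: "\<And>t. t \<in> T \<Longrightarrow> t < Max T \<Longrightarrow> \<exists>t'\<in>T. t < t' \<and> t' \<le> B * t"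
    and "t \<in> T"
  shows "Max T \<le> B ^ card T * t"
proof -
  have "Max T \<le> B ^ card {u \<in> T. t < u} * t" if "t \<in> T" for t
    using that
  proof (induction "card {u \<in> T. t < u}" arbitrary: t rule: less_induct)
    case less
    show ?case
    proof (cases "t < Max T")
      case True
      then obtain t' where t': "t' \<in> T" "t < t'" "t' \<le> B * t" using no_gap less.prems by blast
      have "{u \<in> T. t' < u} \<subset> {u \<in> T. t < u}" using t' by auto
      then have lt: "card {u \<in> T. t' < u} < card {u \<in> T. t < u}"
        using assms(1) by (intro psubset_card_mono) auto
      have "Max T \<le> B ^ card {u \<in> T. t' < u} * t'" by (rule less.hyps[OF lt t'(1)])
      also have "\<dots> \<le> B ^ card {u \<in> T. t' < u} * (B * t)"
        using t' assms(2) by (intro mult_left_mono) auto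
      also have "\<dots> = B ^ Suc (card {u \<in> T. t' < u}) * t" by simp
      also have "\<dots> \<le> B ^ card {u \<in> T. t < u} * t"
        using lt assms(2) assms(3)[OF less.prems] by (intro mult_right_mono power_increasing) auto
      finally show ?thesis .
    next
      case False
      then have "Max T \<le> 1 * t" by simp
      also have "\<dots> \<le> B ^ card {u \<in> T. t < u} * t"
        using assms(2) assms(3)[OF less.prems] by (intro mult_right_mono one_le_power) auto
      finally show ?thesis .
    qed
  qed
  then have "Max T \<le> B ^ card {u \<in> T. t < u} * t" using assms(5) .
  also have "\<dots> \<le> B ^ card T * t"
    using assms by (intro mult_right_mono power_increasing card_mono) (auto intro: less_imp_le)
  finally show ?thesis .
qed

lemma distances_mono: "S \<subseteq> S' \<Longrightarrow> distances d S \<subseteq> distances d S'"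
  by (auto simp: distances_def)

text \<open>\<open>Z\<close> is a maximal subset of \<open>S\<close> whose points are pairwise further apart than \<open>t\<close>. By the gap
  above \<open>t\<close> the points of \<open>S\<close> close to a given centre in \<open>Z\<close> are at mutual distance at most \<open>t\<close>.\<close>

lemma gap_decomposition:
  fixes q :: "'a \<Rightarrow> 'a \<Rightarrow> real"
  assumes "finite S" "\<And>x y. q x y = q y x" "\<And>x. q x x = 0" "t \<ge> 0"
    and triangle: "\<And>x y z. q x z \<le> K * (q x y + q y z)" and "K \<ge> 0"
    and gap: "\<And>u. u \<in> distances q S \<Longrightarrow> t < u \<Longrightarrow> 2 * K * t < u"
  obtains Z W where "Z \<subseteq> S" "\<And>u. u \<in> distances q Z \<Longrightarrow> t < u"
    "\<And>z. z \<in> Z \<Longrightarrow> W z \<subseteq> S" "\<And>z u. z \<in> Z \<Longrightarrow> u \<in> distances q (W z) \<Longrightarrow> u \<le> t"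
    "S = (\<Union>z\<in>Z. W z)"
proof -
  let ?F = "{Z. Z \<subseteq> S \<and> (\<forall>u\<in>distances q Z. t < u)}"
  have "finite ?F" using assms(1) by simp
  moreover have "{} \<in> ?F" by (simp add: distances_def)
  ultimately have "\<exists>Z\<in>?F. \<forall>Z'\<in>?F. Z \<subseteq> Z' \<longrightarrow> Z = Z'"
    by (intro finite_has_maximal) (simp, metis (lifting) empty_iff)
  then obtain Z where Z: "Z \<in> ?F" and max: "\<forall>Z'\<in>?F. Z \<subseteq> Z' \<longrightarrow> Z = Z'"
    by (rule bexE)
  \<comment> \<open>The clusters may overlap; a cover of \<open>S\<close> is enough for
    counting.\<close>
  define W where "W z = {x \<in> S. q x z \<le> t}" for z
  \<comment> \<open>A point farther than \<open>t\<close> from every centre could be added to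
    \<open>Z\<close>, against maximality.\<close>
  have cover: "\<exists>z\<in>Z. q x z \<le> t" if "x \<in> S" for x
  proof (rule ccontr)
    assume contr: "\<not> ?thesis"
    then have far: "t < q x z" if "z \<in> Z" for z using that by (simp add: not_le)
    then have "t < q z x" if "z \<in> Z" for z using that assms(2)[of z x] by simp
    moreover have "distances q (insert x Z) \<subseteq> distances q Z \<union> q x ` Z \<union> (\<lambda>z. q z x) ` Z"
      by (auto simp: distances_def)
    ultimately have "insert x Z \<in> ?F" using far Z that by auto
    then have "Z = insert x Z" using bspec[OF max] by blast
    then have "x \<in> Z" by blast
    then show False using far assms(3)[of x] assms(4) by force
  qed
  \<comment> \<open>Through the centre, two points of a cluster have \<open>q\<close> at most 2Kt,
    and no value occurring in \<open>S\<close> lies above t and up to 2Kt.\<close>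
  have close: "u \<le> t" if z: "z \<in> Z" and u: "u \<in> distances q (W z)" for z u
  proof -
    obtain x y where xy: "x \<in> S" "y \<in> S" "x \<noteq> y" "q x z \<le> t" "q y z \<le> t" "u = q x y"
      using u by (auto simp: distances_def W_def)
    have "u \<le> K * (q x z + q z y)" using triangle xy by simp
    also have "\<dots> \<le> K * (t + t)"
      using xy assms(2)[of z y] \<open>K \<ge> 0\<close> by (intro mult_left_mono add_mono) auto
    finally have "\<not> 2 * K * t < u" by simp
    moreover have "u \<in> distances q S" using xy by (auto simp: distances_def)
    ultimately show ?thesis using gap by force
  qed
  show ?thesis
  proof (rule that[of Z W])
    show "S = (\<Union>z\<in>Z. W z)" using cover by (auto simp: W_def)
  qed (use Z close in \<open>auto simp: W_def\<close>)
qed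

text \<open>Strong induction on \<open>s\<close>, allowing at most \<open>s\<close> values so that
  the claim passes to subsets. A gap is a ratio above 2K between neighbouring values. Without one,
  all values agree up to the factor (2K)^s; with one, the centres and each cluster have fewer
  values.\<close>

lemma card_le_powr_lp_pdist:
  fixes p :: real
  assumes "p \<ge> 1" "2 * p > real s"
  shows "\<exists>c\<ge>1. \<forall>n\<ge>1. \<forall>S. finite S \<and> S \<subseteq> Rn n \<and> card (distances (lp_pdist p n) S) \<le> s \<longrightarrow>
    real (card S) \<le> c * real n powr distance_exponent p s"
  using assms(2)
proof (induction s rule: less_induct)
  case (less s)
  define K :: real where "K = 2 powr p"
  have K1: "K \<ge> 1" using assms(1) by (simp add: K_def ge_one_powr_ge_zero)
  define R where "R = (2 * K) ^ s"
  have "R \<ge> 1" unfolding R_def using K1 by (intro one_le_power) simp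
  then obtain c0 :: real where c0: "c0 \<ge> 1"
    and no_gap: "\<And>n S. n \<ge> 1 \<Longrightarrow> finite S \<Longrightarrow>
      (\<And>x y. x \<in> S \<Longrightarrow> y \<in> S \<Longrightarrow> x \<noteq> y \<Longrightarrow> lp_pdist p n x y > 0) \<Longrightarrow>
      (\<And>a b. a \<in> distances (lp_pdist p n) S \<Longrightarrow> b \<in> distances (lp_pdist p n) S \<Longrightarrow> b \<le> R * a) \<Longrightarrow>
      card (distances (lp_pdist p n) S) \<le> s \<Longrightarrow>
      real (card S) \<le> c0 * real n powr distance_exponent p s"
    by (rule bounded_ratio_card_bound[OF assms(1) less.prems]) blast
  have "\<forall>k\<in>{..<s}. \<exists>c\<ge>1. \<forall>n\<ge>1. \<forall>S. finite S \<and> S \<subseteq> Rn n \<and> card (distances (lp_pdist p n) S) \<le> k \<longrightarrow>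
    real (card S) \<le> c * real n powr distance_exponent p k"
    using less by simp
  from bchoice[OF this] obtain c where c: "\<forall>k\<in>{..<s}. c k \<ge> 1 \<and>
    (\<forall>n\<ge>1. \<forall>S. finite S \<and> S \<subseteq> Rn n \<and> card (distances (lp_pdist p n) S) \<le> k \<longrightarrow>
      real (card S) \<le> c k * real n powr distance_exponent p k)"
    by (rule exE)
  then have c1: "c k \<ge> 1" if "k < s" for k using that by simp
  have IH: "real (card S) \<le> c k * real n powr distance_exponent p k"
    if "k < s" "n \<ge> 1" "finite S" "S \<subseteq> Rn n" "card (distances (lp_pdist p n) S) \<le> k" for k n S
    using c that by simp
  \<comment> \<open>One constant dominating those of all smaller cases, so that the result does not
    depend on where the gap falls.\<close>
  define c' where "c' = (\<Sum>k<s. c k)"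
  have c_le: "c k \<le> c'" if "k < s" for k
    unfolding c'_def using that c1 by (intro member_le_sum) (auto intro: order_trans[OF zero_le_one])
  have c'0: "c' \<ge> 0" unfolding c'_def using c1 by (intro sum_nonneg) (auto intro: order_trans[OF zero_le_one])
  \<comment> \<open>\<open>c0\<close> serves the case without a gap, \<open>c' * c'\<close> the
    product of the bounds for centres and clusters.\<close>
  define C where "C = c0 + c' * c'"
  have "real (card S) \<le> C * real n powr distance_exponent p s"
    if n: "n \<ge> 1" and fin: "finite S" and SR: "S \<subseteq> Rn n"
      and cardT: "card (distances (lp_pdist p n) S) \<le> s" for n S
  proof -
    let ?q = "lp_pdist p n"
    define T where "T = distances ?q S"
    have finT: "finite T" using fin by (simp add: T_def finite_distances)
    have pos: "?q x y > 0" if "x \<in> S" "y \<in> S" "x \<noteq> y" for x y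
      using that SR by (auto intro: lp_pdist_pos)
    then have T_pos: "a > 0" if "a \<in> T" for a using that by (auto simp: T_def distances_def)
    show ?thesis
    proof (cases "\<forall>t\<in>T. t < Max T \<longrightarrow> (\<exists>t'\<in>T. t < t' \<and> t' \<le> 2 * K * t)")
      case True
      have ratio: "b \<le> R * a" if "a \<in> T" "b \<in> T" for a b
      proof -
        have "b \<le> Max T" using that finT by simp
        also have "\<dots> \<le> (2 * K) ^ card T * a"
          using finT K1 T_pos True that by (intro no_gap_ratio_le) auto
        also have "\<dots> \<le> R * a"
          unfolding R_def using K1 cardT T_pos[OF that(1)]
          by (intro mult_right_mono power_increasing) (auto simp: T_def)
        finally show ?thesis .
      qed
      have "real (card S) \<le> c0 * real n powr distance_exponent p s"
        using n fin pos ratio cardT by (intro no_gap) (auto simp: T_def)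
      also have "\<dots> \<le> C * real n powr distance_exponent p s"
        using c'0 by (intro mult_right_mono) (auto simp: C_def)
      finally show ?thesis .
    next
      case False
      then obtain t where t: "t \<in> T" "t < Max T" and gap: "\<And>u. u \<in> T \<Longrightarrow> t < u \<Longrightarrow> 2 * K * t < u"
        by (meson not_le)
      have neT: "Max T \<in> T" using finT t(1) by (intro Max_in) auto
      obtain Z W where Z: "Z \<subseteq> S" "\<And>u. u \<in> distances ?q Z \<Longrightarrow> t < u"
        and W: "\<And>z. z \<in> Z \<Longrightarrow> W z \<subseteq> S" "\<And>z u. z \<in> Z \<Longrightarrow> u \<in> distances ?q (W z) \<Longrightarrow> u \<le> t"
        and S: "S = (\<Union>z\<in>Z. W z)"
      proof (rule gap_decomposition[of S ?q t K])
        show "?q x z \<le> K * (?q x y + ?q y z)" for x y z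
          unfolding K_def using assms(1) by (intro lp_pdist_quasi_triangle) simp
        show "2 * K * t < u" if "u \<in> distances ?q S" "t < u" for u
          using gap that by (simp add: T_def)
        show "t \<ge> 0" using T_pos[OF t(1)] by simp
      qed (use fin K1 lp_pdist_commute in auto)
      \<comment> \<open>The centres see only the j values above the gap, each cluster only the k
        values up to \<open>t\<close>. Since \<open>Max T\<close> is counted by j and
        \<open>t\<close> by k, both are positive and hence less than \<open>s\<close>.\<close>
      define j k where "j = card {u \<in> T. t < u}" and "k = card {u \<in> T. u \<le> t}"
      have "T = {u \<in> T. t < u} \<union> {u \<in> T. u \<le> t}" by auto
      then have "card T = j + k"
        unfolding j_def k_def using finT by (subst card_Un_disjoint[symmetric]) auto
      then have jk: "j + k \<le> s" using cardT by (simp add: T_def)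
      have "j > 0" unfolding j_def using finT t neT by (auto simp: card_gt_0_iff)
      moreover have "k > 0" unfolding k_def using finT t by (auto simp: card_gt_0_iff)
      ultimately have lt: "j < s" "k < s" using jk by auto
      have cardZ: "real (card Z) \<le> c j * real n powr distance_exponent p j"
      proof (rule IH[OF lt(1) n])
        show "card (distances ?q Z) \<le> j" unfolding j_def
          using Z finT distances_mono[OF Z(1)] by (intro card_mono) (auto simp: T_def)
      qed (use Z SR fin finite_subset in auto)
      have cardW: "real (card (W z)) \<le> c k * real n powr distance_exponent p k" if z: "z \<in> Z" for z
      proof (rule IH[OF lt(2) n])
        show "card (distances ?q (W z)) \<le> k" unfolding k_def
          using W(2)[OF z] finT distances_mono[OF W(1)[OF z]] by (intro card_mono) (auto simp: T_def)
      qed (use W(1)[OF z] SR fin finite_subset in auto)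
      have finZ: "finite Z" using Z(1) fin by (rule finite_subset)
      have "real (card S) \<le> real (\<Sum>z\<in>Z. card (W z))"
        unfolding of_nat_le_iff by (subst S) (rule card_UN_le[OF finZ])
      also have "\<dots> \<le> (\<Sum>z\<in>Z. c k * real n powr distance_exponent p k)"
        unfolding of_nat_sum by (intro sum_mono cardW)
      also have "\<dots> = real (card Z) * (c k * real n powr distance_exponent p k)" by simp
      also have "\<dots> \<le> (c j * real n powr distance_exponent p j) * (c k * real n powr distance_exponent p k)"
        using c1[OF lt(2)] by (intro mult_right_mono cardZ) auto
      also have "\<dots> = (c j * c k) * real n powr (distance_exponent p j + distance_exponent p k)"
        by (simp add: powr_add)
      also have "\<dots> \<le> (c' * c') * real n powr distance_exponent p s"
        using c_le[OF lt(1)] c_le[OF lt(2)] c1[OF lt(1)] c1[OF lt(2)] n c'0 assms(1) jk less.prems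
        by (intro mult_mono powr_mono distance_exponent_superadditive) auto
      also have "\<dots> \<le> C * real n powr distance_exponent p s"
        using c0 by (intro mult_right_mono) (auto simp: C_def)
      finally show ?thesis .
    qed
  qed
  moreover have "C \<ge> 1" using c0 c'0 by (simp add: C_def add_increasing2)
  ultimately show ?case by blast
qed

section \<open>From p-th powers and finite sets back to \<open>max_s_distance\<close>\<close>

theorem theorem3:
  fixes s :: nat and p :: real
  assumes "s \<ge> 1" and "p \<ge> 1" and "2 * p > real s"
  shows "\<exists>c :: real. \<forall>n :: nat. n \<ge> 1 \<longrightarrow>
           ereal_of_enat (max_s_distance s (Rn n) (lp_dist p n))
             \<le> ereal (c * real n powr ((2 * p * real s + 2 * real s) / (2 * p - real s)))"
proof -
  obtain c where c: "c \<ge> 1" "\<And>n S. n \<ge> 1 \<Longrightarrow> finite S \<Longrightarrow> S \<subseteq> Rn n \<Longrightarrow>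
      card (distances (lp_pdist p n) S) \<le> s \<Longrightarrow> real (card S) \<le> c * real n powr distance_exponent p s"
    using card_le_powr_lp_pdist[OF assms(2,3)] by blast
  have "ereal_of_enat (max_s_distance s (Rn n) (lp_dist p n)) \<le> ereal (c * real n powr distance_exponent p s)"
    if n: "n \<ge> 1" for n
  proof -
    let ?B = "c * real n powr distance_exponent p s"
    have B0: "?B \<ge> 0" using c(1) by simp
    \<comment> \<open>Finite subsets come first, since \<open>S\<close> might a priori be infinite.
      \<open>F\<close> may have fewer distances than \<open>S\<close>, which a bound for at most
      \<open>s\<close> values permits.\<close>
    have finite_bound: "card F \<le> nat \<lfloor>?B\<rfloor>"
      if S: "s_distance_set s (Rn n) (lp_dist p n) S" and F: "F \<subseteq> S" "finite F" for S F
    proof -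
      have "lp_pdist p n x y = lp_dist p n x y powr p" for x y
        using assms(2) by (simp add: lp_dist_eq_pdist powr_powr lp_pdist_def sum_nonneg)
      \<comment> \<open>The p-th powers are an image of the distances, so there are no more of
        them.\<close>
      then have "distances (lp_pdist p n) F = (\<lambda>u. u powr p) ` distances (lp_dist p n) F"
        by (auto simp: distances_def)
      also have "\<dots> \<subseteq> (\<lambda>u. u powr p) ` distances (lp_dist p n) S"
        by (intro image_mono distances_mono F)
      finally have "card (distances (lp_pdist p n) F) \<le> card ((\<lambda>u. u powr p) ` distances (lp_dist p n) S)"
        using S by (intro card_mono) (auto simp: s_distance_set_def)
      also have "\<dots> \<le> s" using S card_image_le by (auto simp: s_distance_set_def)
      finally have "real (card F) \<le> ?B"
        using n F S by (intro c(2)) (auto simp: s_distance_set_def)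
      then show ?thesis by (simp add: le_nat_floor)
    qed
    have "finite S \<and> card S \<le> nat \<lfloor>?B\<rfloor>" if S: "s_distance_set s (Rn n) (lp_dist p n) S" for S
    proof -
      have "finite S"
      proof (rule ccontr)
        \<comment> \<open>An infinite set would contain a finite subset with one point more than the
          bound.\<close>
        assume "infinite S"
        then obtain F where "F \<subseteq> S" "finite F" "card F = Suc (nat \<lfloor>?B\<rfloor>)"
          using infinite_arbitrarily_large by blast
        then show False using finite_bound[OF S, of F] by simp
      qed
      then show ?thesis using finite_bound[OF S, of S] by simp
    qed
    then have "max_s_distance s (Rn n) (lp_dist p n) \<le> enat (nat \<lfloor>?B\<rfloor>)"
      unfolding max_s_distance_le_iff by blast
    then have "ereal_of_enat (max_s_distance s (Rn n) (lp_dist p n)) \<le> ereal_of_enat (enat (nat \<lfloor>?B\<rfloor>))"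
      unfolding ereal_of_enat_le_iff .
    also have "\<dots> \<le> ereal ?B" using B0 by simp
    finally show ?thesis .
  qed
  then show ?thesis unfolding distance_exponent_def by blast
qed

end
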